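(* Let $n, m$ be positive integers and let $f : \mathbb{Z}^{n+m} \to \mathbb{R} \cup \{+\infty\}$ be a globally discrete midpoint convex function. Let $g$ be the projection of $f$ to $\mathbb{Z}^{n}$, i.e., $g(x) = \inf\{ f(x,y) \mid y \in \mathbb{Z}^{m} \}$ for $x \in \mathbb{Z}^{n}$, and assume that $g(x) > -\infty$ for all $x \in \mathbb{Z}^{n}$. Then $g : \mathbb{Z}^{n} \to \mathbb{R} \cup \{+\infty\}$ is a globally discrete midpoint convex function.
   Context: For a real vector $x$, $\lceil x \rceil$ and $\lfloor x \rfloor$ denote componentwise rounding-up and rounding-down to the nearest integers. A function $f : \mathbb{Z}^{d} \to \mathbb{R} \cup \{+\infty\}$ is globally discrete midpoint convex if $$ f(x) + f(y) \ge f\left( \left\lceil \frac{x+y}{2} \right\rceil \right) + f\left( \left\lfloor \frac{x+y}{2} \right\rfloor \right) $$ holds for every pair $(x,y) \in \mathbb{Z}^{d} \times \mathbb{Z}^{d}$ with $\|x-y\|_{\infty} \ge 2$. *)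

theory Defs
  imports "HOL-Analysis.Analysis"
begin

text \<open>
  The lattice \<open>\<int>\<^sup>d\<close> is the type \<open>int ^ 'd\<close> with \<open>d = CARD('d)\<close>, and
  \<open>\<int>\<^sup>n\<^sup>+\<^sup>m\<close> is \<open>int ^ ('n + 'm)\<close>; index types are nonempty, so dimensions are positive.
  Values in \<open>\<real> \<union> {+\<infinity>}\<close> are elements of \<^typ>\<open>ereal\<close> different from \<open>-\<infinity>\<close>.
\<close>

definition real_vec :: "int ^ 'd \<Rightarrow> real ^ 'd" where
  "real_vec x = (\<chi> i. real_of_int (x $ i))"

definition vec_ceiling :: "real ^ 'd \<Rightarrow> int ^ 'd" where
  "vec_ceiling x = (\<chi> i. \<lceil>x $ i\<rceil>)"

definition vec_floor :: "real ^ 'd \<Rightarrow> int ^ 'd" where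
  "vec_floor x = (\<chi> i. \<lfloor>x $ i\<rfloor>)"

definition midpoint_ceiling :: "int ^ 'd \<Rightarrow> int ^ 'd \<Rightarrow> int ^ 'd" where
  "midpoint_ceiling x y = vec_ceiling ((real_vec x + real_vec y) /\<^sub>R 2)"

definition midpoint_floor :: "int ^ 'd \<Rightarrow> int ^ 'd \<Rightarrow> int ^ 'd" where
  "midpoint_floor x y = vec_floor ((real_vec x + real_vec y) /\<^sub>R 2)"

text \<open>The first conjunct says that \<open>f\<close> takes its values in \<open>\<real> \<union> {+\<infinity>}\<close>.\<close>

definition globally_discrete_midpoint_convex :: "(int ^ 'd \<Rightarrow> ereal) \<Rightarrow> bool" where
  "globally_discrete_midpoint_convex f \<longleftrightarrow>
     (\<forall>x. f x \<noteq> -\<infinity>) \<and>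
     (\<forall>x y. infnorm (real_vec x - real_vec y) \<ge> 2 \<longrightarrow>
        f x + f y \<ge> f (midpoint_ceiling x y) + f (midpoint_floor x y))"

definition join_vec :: "'a ^ 'n \<Rightarrow> 'a ^ 'm \<Rightarrow> 'a ^ ('n::finite + 'm::finite)" where
  "join_vec x y = (\<chi> i. case i of Inl j \<Rightarrow> x $ j | Inr k \<Rightarrow> y $ k)"

definition projection :: "(int ^ ('n::finite + 'm::finite) \<Rightarrow> ereal) \<Rightarrow> int ^ 'n \<Rightarrow> ereal" where
  "projection f x = (INF y :: int ^ 'm. f (join_vec x y))"

end

theory Submission imports Defs begin

text \<open>
  Rounded midpoints are taken componentwise, so they commute with joining vectors, and joining
  can only increase the \<open>\<ell>\<^sub>\<infinity>\<close>-distance. Hence the inequality for \<open>f\<close> at \<open>((x, y), (x', y'))\<close>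
  bounds \<open>f (x, y) + f (x', y')\<close> from below by the projected values at the two midpoints of
  \<open>x\<close> and \<open>x'\<close>, whatever \<open>y\<close> and \<open>y'\<close> are.
\<close>

text \<open>Each \<open>\<bar>x $ i\<bar>\<close> is also some \<open>\<bar>z $ j\<bar>\<close>, so
  the maximum defining \<open>infnorm z\<close> dominates it.\<close>

lemma infnorm_le_infnorm_reindex:
  fixes x :: "real ^ 'n" and z :: "real ^ 'm"
  assumes "\<And>i. x $ i = z $ h i"
  shows "infnorm x \<le> infnorm z"
  unfolding infnorm_cart[of x]
  using component_le_infnorm_cart[of z] by (intro cSup_least) (auto simp: assms)

lemma infnorm_diff_le_join_vec:
  "infnorm (real_vec x - real_vec x')
    \<le> infnorm (real_vec (join_vec x y) - real_vec (join_vec x' y'))"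
  by (rule infnorm_le_infnorm_reindex[where h = Inl]) (simp add: real_vec_def join_vec_def)

lemma midpoint_ceiling_join_vec:
  "midpoint_ceiling (join_vec x y) (join_vec x' y')
    = join_vec (midpoint_ceiling x x') (midpoint_ceiling y y')"
  by (simp add: vec_eq_iff midpoint_ceiling_def vec_ceiling_def real_vec_def join_vec_def
      split: sum.split)

lemma midpoint_floor_join_vec:
  "midpoint_floor (join_vec x y) (join_vec x' y')
    = join_vec (midpoint_floor x x') (midpoint_floor y y')"
  by (simp add: vec_eq_iff midpoint_floor_def vec_floor_def real_vec_def join_vec_def
      split: sum.split)

text \<open>A finite \<open>a\<close> can be subtracted, which leaves \<open>c - a\<close> as a
  lower bound of all \<open>b i\<close>; for \<open>a = \<infinity>\<close> the right-hand side is
  \<open>\<infinity>\<close>.\<close>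

lemma le_add_INF_ereal:
  fixes a c :: ereal
  assumes "a \<noteq> -\<infinity>" and "\<And>i. i \<in> I \<Longrightarrow> c \<le> a + b i"
  shows "c \<le> a + (INF i\<in>I. b i)"
proof (cases a)
  case (real r)
  have "c - a \<le> (INF i\<in>I. b i)"
    using assms(2) by (intro INF_greatest) (simp add: real ereal_minus_le_iff add.commute)
  then show ?thesis
    by (simp add: real ereal_minus_le_iff add.commute)
qed (use assms in auto)

text \<open>The infima are taken one at a time: over \<open>j\<close> with \<open>a i\<close> fixed,
  then over \<open>i\<close> with the infimum of \<open>b\<close> fixed.\<close>

lemma le_INF_add_INF_ereal:
  fixes c :: ereal
  assumes "\<And>i. i \<in> I \<Longrightarrow> a i \<noteq> -\<infinity>" and "(INF j\<in>J. b j) \<noteq> -\<infinity>"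
    and "\<And>i j. i \<in> I \<Longrightarrow> j \<in> J \<Longrightarrow> c \<le> a i + b j"
  shows "c \<le> (INF i\<in>I. a i) + (INF j\<in>J. b j)"
proof -
  have "c \<le> (INF j\<in>J. b j) + a i" if "i \<in> I" for i
    using le_add_INF_ereal[of "a i" J c b] assms(1,3) that by (simp add: add.commute)
  then show ?thesis
    using le_add_INF_ereal[of "INF j\<in>J. b j" I c a] assms(2) by (simp add: add.commute)
qed

theorem theorem3p5:
  fixes f :: "int ^ ('n::finite + 'm::finite) \<Rightarrow> ereal"
    and g :: "int ^ 'n \<Rightarrow> ereal"
  assumes "globally_discrete_midpoint_convex f"
    and "g = projection f"
    and "\<And>x. g x > -\<infinity>"
  shows "globally_discrete_midpoint_convex g"
  unfolding globally_discrete_midpoint_convex_def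
proof (intro conjI allI impI)
  show "g x \<noteq> -\<infinity>" for x
    using assms(3)[of x] by auto
next
  fix x x' :: "int ^ 'n"
  assume far: "2 \<le> infnorm (real_vec x - real_vec x')"
  have g_le: "g u \<le> f (join_vec u v)" for u and v :: "int ^ 'm"
    unfolding assms(2) projection_def by (rule INF_lower) simp
  have "g (midpoint_ceiling x x') + g (midpoint_floor x x') \<le> f (join_vec x y) + f (join_vec x' y')"
    for y y' :: "int ^ 'm"
  proof -
    have "g (midpoint_ceiling x x') + g (midpoint_floor x x')
        \<le> f (midpoint_ceiling (join_vec x y) (join_vec x' y'))
          + f (midpoint_floor (join_vec x y) (join_vec x' y'))"
      \<comment> \<open>The rounded midpoints of \<open>y\<close> and \<open>y'\<close> serve as
        \<open>v\<close> in \<open>g_le\<close>.\<close>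
      unfolding midpoint_ceiling_join_vec midpoint_floor_join_vec by (intro add_mono g_le)
    also have "\<dots> \<le> f (join_vec x y) + f (join_vec x' y')"
      using assms(1) order_trans[OF far infnorm_diff_le_join_vec]
      unfolding globally_discrete_midpoint_convex_def by blast
    finally show ?thesis .
  qed
  moreover have "f z \<noteq> -\<infinity>" for z
    using assms(1) unfolding globally_discrete_midpoint_convex_def by blast
  \<comment> \<open>The bound holds for independent \<open>y\<close> and \<open>y'\<close>;
    \<open>g x' > -\<infinity>\<close> says that the second infimum is not
    \<open>-\<infinity>\<close>.\<close>
  ultimately have "g (midpoint_ceiling x x') + g (midpoint_floor x x')
      \<le> (INF y :: int ^ 'm. f (join_vec x y)) + (INF y' :: int ^ 'm. f (join_vec x' y'))"
    using assms(3)[of x'] by (intro le_INF_add_INF_ereal) (auto simp: assms(2) projection_def)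
  then show "g (midpoint_ceiling x x') + g (midpoint_floor x x') \<le> g x + g x'"
    by (simp add: assms(2) projection_def)
qed

end
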